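(* Let $X$ be a convex subset of a Euclidean space $\mathbb{R}^n$ and let $\succcurlyeq$ be a complete and transitive binary relation on $X$. Assume that at least one of the following holds: (i) $X$ is either open in $\mathbb{R}^n$ or a polyhedron, and $\succcurlyeq$ is convex; or (ii) for all $x,y\in X$ there exist $a,b\in X$ such that $a\geq x$, $a\geq y$, $x\geq b$, $y\geq b$ (coordinatewise), and $\succcurlyeq$ is weakly monotonic. Then the following seven properties of $\succcurlyeq$ are equivalent: graph continuous; continuous; linearly continuous; mixture-continuous; Archimedean; Wold-continuous; weakly Wold-continuous.
   Context: For a binary relation $\succcurlyeq$ on $X$: $x\succ y$ iff $x\succcurlyeq y$ and not $y\succcurlyeq x$; $x\sim y$ iff $x\succcurlyeq y$ and $y\succcurlyeq x$; $x\preccurlyeq y$ iff $y\succcurlyeq x$; $x\prec y$ iff $y\succ x$. Complete: $x\succcurlyeq y$ or $y\succcurlyeq x$ for all $x,y\in X$. For $R\in\{\succcurlyeq,\preccurlyeq,\succ,\prec\}$, $A_R(x)=\{y\in X: y\,R\,x\}$. For $x,y\in X$ and $\lambda\in[0,1]$, $x\lambda y=\lambda x+(1-\lambda)y$. For vectors, $x\ge y$ means $x_i\ge y_i$ for every $i$, and $x>y$ means $x\ge y$ and $x\ne y$. A polyhedron is an intersection of finitely many closed half-spaces of $\mathbb{R}^n$. $\succcurlyeq$ is convex if $A_\succcurlyeq(x)$ is convex for all $x\in X$. $\succcurlyeq$ is weakly monotonic if $x>y$ implies $x\succcurlyeq y$ for all $x,y\in X$. Graph continuous: $\succcurlyeq$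 is closed in $X\times X$ and $\succ$ is open in $X\times X$. Continuous: for all $x\in X$, $A_\succcurlyeq(x)$ and $A_\preccurlyeq(x)$ are closed in $X$, and $A_\succ(x)$ and $A_\prec(x)$ are open in $X$. Linearly continuous: for every straight line $L$ in $X$ (the intersection with $X$ of a one-dimensional affine subspace contained in the affine hull of $X$) and all $x\in X$, $A_\succcurlyeq(x)\cap L$ and $A_\preccurlyeq(x)\cap L$ are closed in $L$, and $A_\succ(x)\cap L$ and $A_\prec(x)\cap L$ are open in $L$. Mixture-continuous: for all $x,y,z\in X$, $\{\lambda\in[0,1]: x\lambda y\succcurlyeq z\}$ and $\{\lambda\in[0,1]: x\lambda y\preccurlyeq z\}$ are closed. Archimedean: for all $x,y,z\in X$ with $x\succ y$ there exist $\lambda,\delta\in(0,1)$ with $x\lambda z\succ y$ and $x\succ y\delta z$. Order dense: $x\succ y$ implies that there exists $z\in X$ with $x\succ z\succ y$. Weakly Wold-continuous: $\succcurlyeq$ is order dense, and $x\succ z\succ y$ implies that the straight line segment joining $x$ to $y$ contains a point $w$ with $w\sim z$. Wold-continuous: $\succcurlyeq$ is order dense, and $x\succ z\succ y$ implies that every curve in $X$ joining $x$ to $y$ (the range of a continuous injective function $m:[0,1]\to X$ with endpoints $x$ and $y$) contains a point $w$ with $w\sim z$. *)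

theory Defs
  imports "HOL-Analysis.Analysis"
begin

text \<open>A preference on \<open>X\<close> is a set of pairs \<open>R \<subseteq> X \<times> X\<close>, where
  \<open>(x, y) \<in> R\<close> reads ``\<open>x\<close> is weakly preferred to \<open>y\<close>''.  The reversed relations are
  \<open>R\<inverse>\<close> and \<open>(strict R)\<inverse>\<close>.\<close>

definition strict :: "'a rel \<Rightarrow> 'a rel" where
  "strict R = {(x, y). (x, y) \<in> R \<and> (y, x) \<notin> R}"

definition indiff :: "'a rel \<Rightarrow> 'a rel" where
  "indiff R = {(x, y). (x, y) \<in> R \<and> (y, x) \<in> R}"

text \<open>Unlike \<^const>\<open>total_on\<close>, completeness includes the case \<open>x = y\<close>, hence reflexivity on \<open>X\<close>.\<close>

definition complete_on :: "'a set \<Rightarrow> 'a rel \<Rightarrow> bool" where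
  "complete_on X R \<longleftrightarrow> (\<forall>x\<in>X. \<forall>y\<in>X. (x, y) \<in> R \<or> (y, x) \<in> R)"

definition section_at :: "'a set \<Rightarrow> 'a rel \<Rightarrow> 'a \<Rightarrow> 'a set" where
  "section_at X S x = {y \<in> X. (y, x) \<in> S}"

definition mix :: "'a::real_vector \<Rightarrow> real \<Rightarrow> 'a \<Rightarrow> 'a" where
  "mix x l y = l *\<^sub>R x + (1 - l) *\<^sub>R y"

definition convex_pref :: "'a::real_vector set \<Rightarrow> 'a rel \<Rightarrow> bool" where
  "convex_pref X R \<longleftrightarrow> (\<forall>x\<in>X. convex (section_at X R x))"

text \<open>On \<^typ>\<open>real ^ 'n\<close> the order is coordinatewise.\<close>

definition weakly_monotonic :: "'a::order set \<Rightarrow> 'a rel \<Rightarrow> bool" where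
  "weakly_monotonic X R \<longleftrightarrow> (\<forall>x\<in>X. \<forall>y\<in>X. x \<ge> y \<and> x \<noteq> y \<longrightarrow> (x, y) \<in> R)"

definition bounded_pairs :: "'a::order set \<Rightarrow> bool" where
  "bounded_pairs X \<longleftrightarrow>
    (\<forall>x\<in>X. \<forall>y\<in>X. \<exists>a\<in>X. \<exists>b\<in>X. a \<ge> x \<and> a \<ge> y \<and> x \<ge> b \<and> y \<ge> b)"

definition graph_continuous :: "'a::topological_space set \<Rightarrow> 'a rel \<Rightarrow> bool" where
  "graph_continuous X R \<longleftrightarrow>
    closedin (top_of_set (X \<times> X)) R \<and> openin (top_of_set (X \<times> X)) (strict R)"

definition continuous_pref :: "'a::topological_space set \<Rightarrow> 'a rel \<Rightarrow> bool" where
  "continuous_pref X R \<longleftrightarrow>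
    (\<forall>x\<in>X. closedin (top_of_set X) (section_at X R x)
         \<and> closedin (top_of_set X) (section_at X (R\<inverse>) x)
         \<and> openin (top_of_set X) (section_at X (strict R) x)
         \<and> openin (top_of_set X) (section_at X ((strict R)\<inverse>) x))"

definition straight_line_in :: "'a::euclidean_space set \<Rightarrow> 'a set \<Rightarrow> bool" where
  "straight_line_in X L \<longleftrightarrow>
    (\<exists>M. affine M \<and> aff_dim M = 1 \<and> M \<subseteq> affine hull X \<and> L = M \<inter> X)"

definition linearly_continuous :: "'a::euclidean_space set \<Rightarrow> 'a rel \<Rightarrow> bool" where
  "linearly_continuous X R \<longleftrightarrow>
    (\<forall>L. straight_line_in X L \<longrightarrow>
      (\<forall>x\<in>X. closedin (top_of_set L) (section_at X R x \<inter> L)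
           \<and> closedin (top_of_set L) (section_at X (R\<inverse>) x \<inter> L)
           \<and> openin (top_of_set L) (section_at X (strict R) x \<inter> L)
           \<and> openin (top_of_set L) (section_at X ((strict R)\<inverse>) x \<inter> L)))"

definition mixture_continuous :: "'a::real_vector set \<Rightarrow> 'a rel \<Rightarrow> bool" where
  "mixture_continuous X R \<longleftrightarrow>
    (\<forall>x\<in>X. \<forall>y\<in>X. \<forall>z\<in>X.
        closed {l \<in> {0..1}. (mix x l y, z) \<in> R}
      \<and> closed {l \<in> {0..1}. (mix x l y, z) \<in> R\<inverse>})"

definition archimedean :: "'a::real_vector set \<Rightarrow> 'a rel \<Rightarrow> bool" where
  "archimedean X R \<longleftrightarrow>
    (\<forall>x\<in>X. \<forall>y\<in>X. \<forall>z\<in>X. (x, y) \<in> strict R \<longrightarrow>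
      (\<exists>l\<in>{0<..<1}. \<exists>d\<in>{0<..<1}.
        (mix x l z, y) \<in> strict R \<and> (x, mix y d z) \<in> strict R))"

definition order_dense :: "'a set \<Rightarrow> 'a rel \<Rightarrow> bool" where
  "order_dense X R \<longleftrightarrow>
    (\<forall>x\<in>X. \<forall>y\<in>X. (x, y) \<in> strict R \<longrightarrow>
      (\<exists>z\<in>X. (x, z) \<in> strict R \<and> (z, y) \<in> strict R))"

definition weakly_wold_continuous :: "'a::real_vector set \<Rightarrow> 'a rel \<Rightarrow> bool" where
  "weakly_wold_continuous X R \<longleftrightarrow> order_dense X R \<and>
    (\<forall>x\<in>X. \<forall>y\<in>X. \<forall>z\<in>X. (x, z) \<in> strict R \<and> (z, y) \<in> strict R \<longrightarrow>
      (\<exists>w\<in>closed_segment x y. (w, z) \<in> indiff R))"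

definition wold_continuous :: "'a::real_normed_vector set \<Rightarrow> 'a rel \<Rightarrow> bool" where
  "wold_continuous X R \<longleftrightarrow> order_dense X R \<and>
    (\<forall>x\<in>X. \<forall>y\<in>X. \<forall>z\<in>X. (x, z) \<in> strict R \<and> (z, y) \<in> strict R \<longrightarrow>
      (\<forall>m. arc m \<and> path_image m \<subseteq> X \<and> pathstart m = x \<and> pathfinish m = y \<longrightarrow>
        (\<exists>w\<in>path_image m. (w, z) \<in> indiff R)))"

end

theory Submission
  imports Defs
begin

text \<open>
  The implications graph continuous \<open>\<Rightarrow>\<close> continuous \<open>\<Rightarrow>\<close> linearly continuous \<open>\<Rightarrow>\<close>
  mixture-continuous \<open>\<Rightarrow>\<close> Archimedean and continuous \<open>\<Rightarrow>\<close> Wold \<open>\<Rightarrow>\<close> weakly Wold \<open>\<Rightarrow>\<close>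
  Archimedean hold on every convex set, and continuous implies graph continuous on every
  topological space, so the content is that Archimedean implies continuous.

  Under (i), the strict upper sections are convex and contain, with \<open>x\<close>, a point beyond \<open>x\<close> on
  every segment of \<open>X\<close> issuing from \<open>x\<close>.  A neighbourhood of \<open>x\<close> in \<open>X\<close> is the convex hull of
  finitely many points, and shrinking it towards \<open>x\<close> brings it into the section.  An upper section
  is closed because the segment from a relative interior point to a point of its closure lies in
  the section up to the endpoint, and the Archimedean property adds the endpoint.

  Under (ii), choose \<open>b \<le> x\<close> in \<open>X\<close> that is strictly below \<open>x\<close> in every coordinate in which some
  point of \<open>X\<close> is.  If \<open>x \<succ> y\<close>, some \<open>x l b \<succ> y\<close>, and all points of \<open>X\<close> near \<open>x\<close> are \<open>\<ge> x l b\<close>.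
\<close>

section \<open>Mixtures and relatively open sets\<close>

lemma mix_in_convex:
  assumes "convex X" "x \<in> X" "y \<in> X" "0 \<le> l" "l \<le> 1"
  shows "mix x l y \<in> X"
  using assms by (simp add: mix_def convexD)

lemma mix_same [simp]: "mix x l x = x"
  by (simp add: mix_def flip: scaleR_left_distrib)

lemma mix_1 [simp]: "mix x 1 y = x"
  by (simp add: mix_def)

lemma mix_mix: "mix x l (mix x k y) = mix x (l + (1 - l) * k) y"
  by (simp add: mix_def algebra_simps)

lemma closed_segment_eq_mix: "closed_segment x y = (\<lambda>l. mix x l y) ` {0..1}"
proof -
  have "closed_segment x y = closed_segment y x"
    by (rule closed_segment_commute)
  also have "\<dots> = (\<lambda>l. mix x l y) ` {0..1}"
    by (auto simp: closed_segment_def mix_def add.commute)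
  finally show ?thesis .
qed

lemma continuous_on_mix: "continuous_on S (\<lambda>l. mix x l y)"
  for x y :: "'a::real_normed_vector"
  unfolding mix_def by (intro continuous_intros)

lemma openin_top_of_set_nhdsI:
  assumes "A \<subseteq> X" and "\<And>x. x \<in> A \<Longrightarrow> \<forall>\<^sub>F z in nhds x. z \<in> X \<longrightarrow> z \<in> A"
  shows "openin (top_of_set X) A"
proof (subst openin_subopen, intro ballI)
  fix x assume x: "x \<in> A"
  then obtain T where "open T" "x \<in> T" "\<forall>z\<in>T. z \<in> X \<longrightarrow> z \<in> A"
    using assms(2) unfolding eventually_nhds by blast
  then show "\<exists>T. openin (top_of_set X) T \<and> x \<in> T \<and> T \<subseteq> A"
    using x assms(1) by (intro exI[of _ "X \<inter> T"]) (auto intro: openin_open_Int)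
qed

section \<open>Dilations and locally conic sets\<close>

text \<open>Near each of its points \<open>x\<close>, the set \<open>X\<close> is a cone with apex \<open>x\<close> truncated by a polytope.\<close>

definition locally_conic :: "'a::euclidean_space set \<Rightarrow> bool" where
  "locally_conic X \<longleftrightarrow> (\<forall>x\<in>X. \<exists>P. polytope P \<and> P \<subseteq> X
    \<and> (\<forall>t. 0 < t \<and> t \<le> 1 \<longrightarrow> (\<forall>\<^sub>F z in nhds x. z \<in> X \<longrightarrow> x + (1 / t) *\<^sub>R (z - x) \<in> P)))"

text \<open>The dilation about \<open>x\<close> is continuous and fixes \<open>x\<close>, so the
  preimage of \<open>U\<close> is a neighbourhood of \<open>x\<close>.\<close>

lemma eventually_dilation:
  fixes x :: "'a::real_normed_vector"
  assumes "open U" "x \<in> U"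
  shows "\<forall>\<^sub>F z in nhds x. x + c *\<^sub>R (z - x) \<in> U"
proof -
  have "isCont (\<lambda>z. x + c *\<^sub>R (z - x)) x"
    by (intro continuous_intros)
  then have "((\<lambda>z. x + c *\<^sub>R (z - x)) \<longlongrightarrow> x + c *\<^sub>R (x - x)) (nhds x)"
    using tendsto_at_iff_tendsto_nhds[of "\<lambda>z. x + c *\<^sub>R (z - x)" x] by (simp add: isCont_def)
  then show ?thesis
    using assms by (auto dest: topological_tendstoD)
qed

lemma open_imp_locally_conic:
  fixes X :: "'a::euclidean_space set"
  assumes "open X"
  shows "locally_conic X"
  unfolding locally_conic_def
proof (intro ballI)
  fix x assume "x \<in> X"
  then obtain a b where ab: "x \<in> box a b" "cbox a b \<subseteq> X"
    using assms by (metis open_contains_cbox)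
  show "\<exists>P. polytope P \<and> P \<subseteq> X
      \<and> (\<forall>t. 0 < t \<and> t \<le> 1 \<longrightarrow> (\<forall>\<^sub>F z in nhds x. z \<in> X \<longrightarrow> x + (1 / t) *\<^sub>R (z - x) \<in> P))"
  proof (intro exI conjI allI impI)
    show "\<forall>\<^sub>F z in nhds x. z \<in> X \<longrightarrow> x + (1 / t) *\<^sub>R (z - x) \<in> cbox a b" for t
      using eventually_dilation[OF open_box ab(1), of "1 / t"]
      by eventually_elim (use box_subset_cbox in blast)
  qed (use ab in \<open>auto simp: polytope_interval\<close>)
qed

text \<open>Take \<open>P\<close> to be \<open>X\<close> cut by a box around \<open>x\<close>. A
  half-space with \<open>x\<close> in its interior contains the dilates of all points close to
  \<open>x\<close>; one with \<open>x\<close> on its boundary is a cone with apex \<open>x\<close>,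
  hence invariant under dilation. Finitely many half-spaces allow one common neighbourhood.\<close>

lemma polyhedron_imp_locally_conic:
  fixes X :: "'a::euclidean_space set"
  assumes "polyhedron X"
  shows "locally_conic X"
  unfolding locally_conic_def
proof (intro ballI)
  fix x assume x: "x \<in> X"
  obtain F where F: "finite F" "X = \<Inter>F"
    and half: "\<And>h. h \<in> F \<Longrightarrow> \<exists>a b. a \<noteq> 0 \<and> h = {x. a \<bullet> x \<le> b}"
    using assms unfolding polyhedron_def by blast
  obtain a b where ab: "x \<in> box a b"
    by (metis open_UNIV UNIV_I open_contains_cbox)
  have "\<forall>\<^sub>F z in nhds x. z \<in> h \<longrightarrow> x + (1 / t) *\<^sub>R (z - x) \<in> h"
    if t: "0 < t" "t \<le> 1" and h: "h \<in> F" for t h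
  proof -
    obtain c d where c: "h = {x. c \<bullet> x \<le> d}" using half h by blast
    have "c \<bullet> x \<le> d" using x F(2) h c by blast
    then consider "c \<bullet> x < d" | "c \<bullet> x = d" by linarith
    then show ?thesis
    proof cases
      case 1
      then show ?thesis
        using eventually_dilation[OF open_halfspace_lt[of c d], of x "1 / t"]
        by (auto simp: c elim!: eventually_mono)
    next
      case 2
      then show ?thesis
        using t(1)
        by (auto simp: c inner_simps mult_le_0_iff divide_simps intro!: always_eventually)
    qed
  qed
  then have dil: "\<forall>\<^sub>F z in nhds x. \<forall>h\<in>F. z \<in> h \<longrightarrow> x + (1 / t) *\<^sub>R (z - x) \<in> h"
    if "0 < t" "t \<le> 1" for t
    using F(1) that by (intro eventually_ball_finite) auto
  show "\<exists>P. polytope P \<and> P \<subseteq> X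
      \<and> (\<forall>t. 0 < t \<and> t \<le> 1 \<longrightarrow> (\<forall>\<^sub>F z in nhds x. z \<in> X \<longrightarrow> x + (1 / t) *\<^sub>R (z - x) \<in> P))"
  proof (intro exI conjI allI impI)
    show "polytope (X \<inter> cbox a b)"
      using assms by (simp add: polytope_eq_bounded_polyhedron polyhedron_Int
          bounded_Int polyhedron_interval)
    show "\<forall>\<^sub>F z in nhds x. z \<in> X \<longrightarrow> x + (1 / t) *\<^sub>R (z - x) \<in> X \<inter> cbox a b"
      if "0 < t \<and> t \<le> 1" for t
    proof -
      have "\<forall>\<^sub>F z in nhds x. \<forall>h\<in>F. z \<in> h \<longrightarrow> x + (1 / t) *\<^sub>R (z - x) \<in> h"
        using dil that by blast
      with eventually_dilation[OF open_box ab, of "1 / t"] show ?thesis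
        unfolding F(2) by eventually_elim (use box_subset_cbox in blast)
    qed
  qed auto
qed

section \<open>Complete and transitive relations\<close>

locale weak_order =
  fixes X :: "'a set" and R :: "'a rel"
  assumes sub: "R \<subseteq> X \<times> X"
    and complete: "complete_on X R"
    and trans: "trans R"
begin

lemma strict_mem: "(x, y) \<in> strict R \<Longrightarrow> x \<in> X \<and> y \<in> X"
  using sub by (auto simp: strict_def)

lemma strict_iff: "x \<in> X \<Longrightarrow> y \<in> X \<Longrightarrow> (x, y) \<in> strict R \<longleftrightarrow> (y, x) \<notin> R"
  using complete by (auto simp: strict_def complete_on_def)

lemma refl: "x \<in> X \<Longrightarrow> (x, x) \<in> R"
  using complete by (auto simp: complete_on_def)

lemma strict_imp_pref: "(x, y) \<in> strict R \<Longrightarrow> (x, y) \<in> R"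
  by (simp add: strict_def)

lemma strict_pref_trans: "(x, y) \<in> strict R \<Longrightarrow> (y, z) \<in> R \<Longrightarrow> (x, z) \<in> strict R"
  using trans by (auto simp: strict_def dest: transD)

lemma pref_strict_trans: "(x, y) \<in> R \<Longrightarrow> (y, z) \<in> strict R \<Longrightarrow> (x, z) \<in> strict R"
  using trans by (auto simp: strict_def dest: transD)

lemma section_pref_eq: "x \<in> X \<Longrightarrow> section_at X R x = X - section_at X ((strict R)\<inverse>) x"
  by (auto simp: section_at_def strict_iff)

lemma section_converse_eq: "x \<in> X \<Longrightarrow> section_at X (R\<inverse>) x = X - section_at X (strict R) x"
  by (auto simp: section_at_def strict_iff)

end

section \<open>Graph continuity, continuity and connectedness\<close>

locale topological_weak_order = weak_order X R
  for X :: "'a::topological_space set" and R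
begin

lemma continuous_pref_iff:
  "continuous_pref X R \<longleftrightarrow>
    (\<forall>x\<in>X. openin (top_of_set X) (section_at X (strict R) x)
         \<and> openin (top_of_set X) (section_at X ((strict R)\<inverse>) x))"
  by (auto simp: continuous_pref_def section_pref_eq section_converse_eq)

lemma graph_continuous_imp_continuous:
  assumes "graph_continuous X R"
  shows "continuous_pref X R"
proof -
  have op: "openin (top_of_set (X \<times> X)) (strict R)"
    using assms by (simp add: graph_continuous_def)
  have "openin (top_of_set X) (section_at X (strict R) x)
      \<and> openin (top_of_set X) (section_at X ((strict R)\<inverse>) x)" if "x \<in> X" for x
  proof -
    have "openin (top_of_set X) (X \<inter> (\<lambda>y. (y, x)) -` strict R)"
      "openin (top_of_set X) (X \<inter> (\<lambda>y. (x, y)) -` strict R)"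
      using that by (auto intro!: continuous_openin_preimage[OF _ _ op] continuous_intros)
    moreover have "section_at X (strict R) x = X \<inter> (\<lambda>y. (y, x)) -` strict R"
      "section_at X ((strict R)\<inverse>) x = X \<inter> (\<lambda>y. (x, y)) -` strict R"
      by (auto simp: section_at_def)
    ultimately show ?thesis by simp
  qed
  then show ?thesis by (simp add: continuous_pref_iff)
qed

text \<open>For \<open>x\<close> strictly above \<open>y\<close>, an open rectangle around
  \<open>(x, y)\<close> inside \<open>strict R\<close> is needed. If some \<open>z\<close> lies
  strictly between, use the points above \<open>z\<close> times the points below \<open>z\<close>.
  Otherwise \<open>x\<close> and \<open>y\<close> form a jump: whatever is strictly above
  \<open>y\<close> is weakly above \<open>x\<close>, so the points above \<open>y\<close> times the
  points below \<open>x\<close> will do.\<close>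

lemma continuous_imp_graph_continuous:
  assumes "continuous_pref X R"
  shows "graph_continuous X R"
proof -
  have op1: "openin (top_of_set X) (section_at X (strict R) x)"
    and op2: "openin (top_of_set X) (section_at X ((strict R)\<inverse>) x)" if "x \<in> X" for x
    using assms that by (auto simp: continuous_pref_def)
  have nbhd: "\<exists>U V. openin (top_of_set X) U \<and> openin (top_of_set X) V
      \<and> x \<in> U \<and> y \<in> V \<and> U \<times> V \<subseteq> strict R" if xy: "(x, y) \<in> strict R" for x y
  proof (cases "\<exists>z. (x, z) \<in> strict R \<and> (z, y) \<in> strict R")
    case True
    then obtain z where z: "(x, z) \<in> strict R" "(z, y) \<in> strict R" by blast
    show ?thesis
    proof (intro exI conjI)
      show "section_at X (strict R) z \<times> section_at X ((strict R)\<inverse>) z \<subseteq> strict R"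
        by (auto simp: section_at_def intro: strict_pref_trans strict_imp_pref)
    qed (use z strict_mem op1 op2 in \<open>auto simp: section_at_def\<close>)
  next
    case False
    show ?thesis
    proof (intro exI conjI)
      show "section_at X (strict R) y \<times> section_at X ((strict R)\<inverse>) x \<subseteq> strict R"
      proof clarify
        fix u v
        assume "u \<in> section_at X (strict R) y" "v \<in> section_at X ((strict R)\<inverse>) x"
        then have u: "u \<in> X" "(u, y) \<in> strict R" and v: "(x, v) \<in> strict R"
          by (auto simp: section_at_def)
        have "(u, x) \<in> R"
          using False u xy strict_iff strict_mem by blast
        then show "(u, v) \<in> strict R"
          using v by (rule pref_strict_trans)
      qed
    qed (use xy strict_mem op1 op2 in \<open>auto simp: section_at_def\<close>)
  qed
  have op: "openin (top_of_set (X \<times> X)) (strict R)"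
  proof (subst openin_subopen, clarify)
    fix x y assume "(x, y) \<in> strict R"
    from nbhd[OF this] obtain U V where "openin (top_of_set X) U" "openin (top_of_set X) V"
      "x \<in> U" "y \<in> V" "U \<times> V \<subseteq> strict R"
      by (elim exE conjE)
    then show "\<exists>T. openin (top_of_set (X \<times> X)) T \<and> (x, y) \<in> T \<and> T \<subseteq> strict R"
      by (intro exI[of _ "U \<times> V"]) (auto intro: openin_Times)
  qed
  \<comment> \<open>By completeness the complement of \<open>R\<close> in the square is the converse
    of \<open>strict R\<close>, which is open as a preimage under the swap of coordinates.\<close>
  have "openin (top_of_set (X \<times> X)) (X \<times> X \<inter> prod.swap -` strict R)"
    by (rule continuous_openin_preimage[OF _ _ op]) (auto intro: continuous_on_swap)
  then have "closedin (top_of_set (X \<times> X)) (X \<times> X - X \<times> X \<inter> prod.swap -` strict R)"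
    by (intro closedin_diff) auto
  moreover have "R = X \<times> X - X \<times> X \<inter> prod.swap -` strict R"
    using sub by (auto simp: strict_iff)
  ultimately have "closedin (top_of_set (X \<times> X)) R"
    by simp
  with op show ?thesis by (simp add: graph_continuous_def)
qed

text \<open>Without a point indifferent to \<open>z\<close>, the points strictly above and strictly
  below \<open>z\<close> would disconnect \<open>C\<close>.\<close>

lemma intermediate_indiff:
  assumes "continuous_pref X R" "connected C" "C \<subseteq> X" "x \<in> C" "y \<in> C"
    and "(x, z) \<in> strict R" "(z, y) \<in> strict R"
  shows "\<exists>w\<in>C. (w, z) \<in> indiff R"
proof (rule ccontr)
  assume no: "\<not> ?thesis"
  have z: "z \<in> X" using assms strict_mem by blast
  obtain U V where U: "open U" "section_at X (strict R) z = X \<inter> U"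
    and V: "open V" "section_at X ((strict R)\<inverse>) z = X \<inter> V"
    using assms(1) z by (auto simp: continuous_pref_def openin_open)
  have "C \<subseteq> U \<union> V"
  proof
    fix w assume "w \<in> C"
    then have "w \<in> X" "(w, z) \<notin> R \<or> (z, w) \<notin> R"
      using no assms(3) by (auto simp: indiff_def)
    then have "w \<in> section_at X (strict R) z \<union> section_at X ((strict R)\<inverse>) z"
      using z by (auto simp: section_at_def strict_iff)
    then show "w \<in> U \<union> V" using U V by blast
  qed
  moreover have "U \<inter> V \<inter> C = {}"
  proof -
    have "section_at X (strict R) z \<inter> section_at X ((strict R)\<inverse>) z = {}"
      by (auto simp: section_at_def strict_def)
    then show ?thesis using U V assms(3) by blast
  qed
  moreover have "x \<in> U" "y \<in> V"
    using assms U V by (auto simp: section_at_def)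
  ultimately show False
    using connectedD[OF assms(2) U(1) V(1)] assms(4,5) by blast
qed

text \<open>A jump from \<open>x\<close> down to \<open>y\<close> would disconnect \<open>X\<close>
  into the points above \<open>y\<close> and the points below \<open>x\<close>.\<close>

lemma continuous_imp_order_dense:
  assumes "continuous_pref X R" "connected X"
  shows "order_dense X R"
  unfolding order_dense_def
proof (intro ballI impI, rule ccontr)
  fix x y
  assume x: "x \<in> X" and y: "y \<in> X" and xy: "(x, y) \<in> strict R"
    and no: "\<not> (\<exists>z\<in>X. (x, z) \<in> strict R \<and> (z, y) \<in> strict R)"
  let ?U = "section_at X (strict R) y" and ?V = "section_at X ((strict R)\<inverse>) x"
  have "openin (top_of_set X) ?U" "openin (top_of_set X) ?V"
    using assms(1) x y by (auto simp: continuous_pref_def)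
  \<comment> \<open>A point not below \<open>x\<close> is weakly above \<open>x\<close>, hence
    strictly above \<open>y\<close>.\<close>
  moreover have "X \<subseteq> ?U \<union> ?V"
    using xy x y transD[OF trans] by (auto simp: section_at_def strict_iff)
  moreover have "?U \<inter> ?V = {}"
    using no by (auto simp: section_at_def)
  moreover have "x \<in> ?U" "y \<in> ?V"
    using xy x y by (auto simp: section_at_def)
  ultimately show False
    using assms(2) unfolding connected_openin by blast
qed

end

section \<open>Implications valid on every convex set\<close>

locale convex_weak_order = topological_weak_order X R
  for X :: "'a::euclidean_space set" and R +
  assumes convex: "convex X"
begin

lemma continuous_imp_linearly_continuous:
  assumes "continuous_pref X R"
  shows "linearly_continuous X R"
proof -
  have "closedin (top_of_set L) (S \<inter> L)"
    if "closedin (top_of_set X) S" "L \<subseteq> X" for S L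
    using that by (auto simp: closedin_closed)
  moreover have "openin (top_of_set L) (S \<inter> L)"
    if "openin (top_of_set X) S" "L \<subseteq> X" for S L
    using that by (auto simp: openin_open)
  ultimately show ?thesis
    using assms unfolding linearly_continuous_def continuous_pref_def straight_line_in_def
    by auto
qed

lemma linearly_continuous_imp_mixture_continuous:
  assumes "linearly_continuous X R"
  shows "mixture_continuous X R"
  unfolding mixture_continuous_def
proof (intro ballI)
  fix x y z assume xyz: "x \<in> X" "y \<in> X" "z \<in> X"
  show "closed {l \<in> {0..1}. (mix x l y, z) \<in> R}
      \<and> closed {l \<in> {0..1}. (mix x l y, z) \<in> R\<inverse>}"
  proof (cases "x = y")
    \<comment> \<open>Here the affine hull of the two points is not a line; the condition does not
      depend on \<open>l\<close>, so the set of weights is empty or the whole interval.\<close>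
    case True
    have "{l \<in> {0..1}. P} = {} \<or> {l \<in> {0..1}. P} = {0..1::real}" for P by auto
    then have "closed {l \<in> {0..1::real}. P}" for P
      by (metis closed_empty closed_atLeastAtMost)
    then show ?thesis using True by simp
  next
    case False
    define L where "L = affine hull {x, y} \<inter> X"
    have "straight_line_in X L"
      unfolding straight_line_in_def L_def
      using False xyz hull_mono[of "{x, y}" X affine] by (intro exI[of _ "affine hull {x, y}"]) auto
    then have cl: "closedin (top_of_set L) (section_at X R z \<inter> L)"
      "closedin (top_of_set L) (section_at X (R\<inverse>) z \<inter> L)"
      using assms xyz by (auto simp: linearly_continuous_def)
    have map: "mix x l y \<in> L" if "l \<in> {0..1}" for l
    proof -
      have "\<exists>u v. mix x l y = u *\<^sub>R x + v *\<^sub>R y \<and> u + v = 1"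
        unfolding mix_def by (intro exI[of _ l] exI[of _ "1 - l"]) simp
      then show ?thesis
        using that xyz mix_in_convex[OF convex] unfolding L_def affine_hull_2 by auto
    qed
    have *: "closed {l \<in> {0..1}. (mix x l y, z) \<in> S}"
      if "closedin (top_of_set L) (section_at X S z \<inter> L)" for S
    proof -
      have "closedin (top_of_set {0..1}) ({0..1} \<inter> (\<lambda>l. mix x l y) -` (section_at X S z \<inter> L))"
        using map by (intro continuous_closedin_preimage_gen[OF continuous_on_mix _ that]) auto
      moreover have "{0..1} \<inter> (\<lambda>l. mix x l y) -` (section_at X S z \<inter> L)
          = {l \<in> {0..1}. (mix x l y, z) \<in> S}"
        using map by (auto simp: section_at_def L_def)
      ultimately show ?thesis
        using closedin_closed_trans closed_atLeastAtMost by metis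
    qed
    show ?thesis using *[OF cl(1)] *[OF cl(2)] by blast
  qed
qed

text \<open>The weights violating the desired strict preference form a closed set that misses 1,
  because weight 1 gives back \<open>x\<close>, respectively \<open>y\<close>. Hence weights
  slightly below 1 are good.\<close>

lemma mixture_continuous_imp_archimedean:
  assumes "mixture_continuous X R"
  shows "archimedean X R"
proof -
  have near: "\<exists>l\<in>{0<..<1::real}. l \<notin> S" if S: "closed S" "1 \<notin> S" for S
  proof -
    obtain e where e: "e > 0" "ball 1 e \<subseteq> - S"
      using S by (metis ComplI open_Compl openE)
    let ?l = "1 - min (e / 2) (1 / 2)"
    have "?l \<in> ball 1 e" "?l \<in> {0<..<1}" using e(1) by (auto simp: dist_real_def)
    then show ?thesis using e(2) by blast
  qed
  show ?thesis
    unfolding archimedean_def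
  proof (intro ballI impI)
    fix x y z assume xyz: "x \<in> X" "y \<in> X" "z \<in> X" and xy: "(x, y) \<in> strict R"
    let ?A = "{l \<in> {0..1}. (mix x l z, y) \<in> R\<inverse>}" and ?B = "{l \<in> {0..1}. (mix y l z, x) \<in> R}"
    have "closed ?A" "closed ?B"
      using assms xyz by (auto simp: mixture_continuous_def)
    moreover have "1 \<notin> ?A" "1 \<notin> ?B"
      using xy by (auto simp: strict_def)
    ultimately obtain l d where ld: "l \<in> {0<..<1}" "d \<in> {0<..<1}" "l \<notin> ?A" "d \<notin> ?B"
      using near[of ?A] near[of ?B] by blast
    then have "(y, mix x l z) \<notin> R" "(mix y d z, x) \<notin> R"
      by auto
    moreover have "mix x l z \<in> X" "mix y d z \<in> X"
      using ld xyz by (auto intro: mix_in_convex[OF convex])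
    ultimately show "\<exists>l\<in>{0<..<1}. \<exists>d\<in>{0<..<1}.
        (mix x l z, y) \<in> strict R \<and> (x, mix y d z) \<in> strict R"
      using ld(1,2) xyz strict_iff by blast
  qed
qed

lemma continuous_imp_wold_continuous:
  assumes "continuous_pref X R"
  shows "wold_continuous X R"
  unfolding wold_continuous_def
proof (intro conjI ballI allI impI)
  show "order_dense X R"
    using assms convex by (simp add: continuous_imp_order_dense convex_connected)
  show "\<exists>w\<in>path_image m. (w, z) \<in> indiff R"
    if "(x, z) \<in> strict R \<and> (z, y) \<in> strict R"
      "arc m \<and> path_image m \<subseteq> X \<and> pathstart m = x \<and> pathfinish m = y" for x y z m
    using that
    by (intro intermediate_indiff[OF assms, of _ x y])
      (auto simp: arc_imp_path connected_path_image)
qed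

lemma wold_continuous_imp_weakly_wold_continuous:
  assumes "wold_continuous X R"
  shows "weakly_wold_continuous X R"
  unfolding weakly_wold_continuous_def
proof (intro conjI ballI impI)
  show "order_dense X R" using assms by (simp add: wold_continuous_def)
  fix x y z
  assume xyz: "x \<in> X" "y \<in> X" "z \<in> X" and s: "(x, z) \<in> strict R \<and> (z, y) \<in> strict R"
  then have "x \<noteq> y" by (auto simp: strict_def)
  then have "arc (linepath x y)" by (rule arc_linepath)
  moreover have "path_image (linepath x y) \<subseteq> X"
    using xyz convex by (simp add: closed_segment_subset)
  ultimately have "\<exists>w\<in>path_image (linepath x y). (w, z) \<in> indiff R"
    using assms xyz s unfolding wold_continuous_def
    by (metis pathstart_linepath pathfinish_linepath)
  then show "\<exists>w\<in>closed_segment x y. (w, z) \<in> indiff R" by simp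
qed

text \<open>Weak Wold continuity may return an endpoint of the segment, whereas the Archimedean
  property asks for a weight strictly between 0 and 1. Working on the half of the segment next to
  \<open>x\<close> keeps the weight at least 1/2, and \<open>w\<close> not being indifferent to
  \<open>x\<close> keeps it below 1.\<close>

lemma indiff_between_midpoint:
  assumes "weakly_wold_continuous X R" "x \<in> X" "z \<in> X" "w \<in> X"
    and "(x, w) \<in> strict R \<and> (w, mix x (1/2) z) \<in> strict R
       \<or> (mix x (1/2) z, w) \<in> strict R \<and> (w, x) \<in> strict R"
  shows "\<exists>l\<in>{0<..<1}. (mix x l z, w) \<in> indiff R"
proof -
  let ?v = "mix x (1/2) z"
  have "?v \<in> X" using assms by (intro mix_in_convex[OF convex]) auto
  then have "\<exists>u\<in>closed_segment x ?v. (u, w) \<in> indiff R"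
    using assms unfolding weakly_wold_continuous_def by (metis closed_segment_commute)
  then obtain l where l: "0 \<le> l" "l \<le> 1" "(mix x l ?v, w) \<in> indiff R"
    unfolding closed_segment_eq_mix by auto
  have "l \<noteq> 1" using l assms(5) by (auto simp: strict_def indiff_def)
  then show ?thesis
    using l unfolding mix_mix
    by (intro bexI[of _ "l + (1 - l) * (1/2)"]) (auto simp: field_simps)
qed

text \<open>Order density gives \<open>w\<close> strictly between \<open>x\<close> and
  \<open>y\<close>. If the midpoint of \<open>x\<close> and \<open>z\<close> is not above
  \<open>y\<close>, it is below \<open>w\<close>, so some mixture of \<open>x\<close> and
  \<open>z\<close> is indifferent to \<open>w\<close> and therefore above \<open>y\<close>. The
  other half is dual.\<close>

lemma weakly_wold_continuous_imp_archimedean: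
  assumes "weakly_wold_continuous X R"
  shows "archimedean X R"
  unfolding archimedean_def
proof (intro ballI impI)
  fix x y z assume xyz: "x \<in> X" "y \<in> X" "z \<in> X" and xy: "(x, y) \<in> strict R"
  obtain w where w: "w \<in> X" "(x, w) \<in> strict R" "(w, y) \<in> strict R"
    using assms xyz xy unfolding weakly_wold_continuous_def order_dense_def by blast
  have mid: "mix x (1/2) z \<in> X" "mix y (1/2) z \<in> X"
    using xyz by (auto intro: mix_in_convex[OF convex])
  have "\<exists>l\<in>{0<..<1}. (mix x l z, y) \<in> strict R"
  proof (cases "(mix x (1/2) z, y) \<in> strict R")
    case True
    then show ?thesis by (intro bexI[of _ "1/2"]) auto
  next
    case False
    then have "(w, mix x (1/2) z) \<in> strict R"
      using w mid xyz strict_iff strict_pref_trans by blast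
    then obtain l where "l \<in> {0<..<1}" "(mix x l z, w) \<in> indiff R"
      using indiff_between_midpoint[OF assms, of x z w] xyz w by auto
    then show ?thesis
      using w pref_strict_trans unfolding indiff_def by blast
  qed
  moreover have "\<exists>d\<in>{0<..<1}. (x, mix y d z) \<in> strict R"
  proof (cases "(x, mix y (1/2) z) \<in> strict R")
    case True
    then show ?thesis by (intro bexI[of _ "1/2"]) auto
  next
    case False
    then have "(mix y (1/2) z, w) \<in> strict R"
      using w mid xyz strict_iff pref_strict_trans by blast
    then obtain d where "d \<in> {0<..<1}" "(mix y d z, w) \<in> indiff R"
      using indiff_between_midpoint[OF assms, of y z w] xyz w by auto
    then show ?thesis
      using w strict_pref_trans unfolding indiff_def by blast
  qed
  ultimately show "\<exists>l\<in>{0<..<1}. \<exists>d\<in>{0<..<1}.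
      (mix x l z, y) \<in> strict R \<and> (x, mix y d z) \<in> strict R"
    by blast
qed

section \<open>Archimedean convex preferences are continuous\<close>

lemma convex_strict_section:
  assumes "convex_pref X R"
  shows "convex (section_at X (strict R) y)"
  unfolding convex_alt
proof (intro ballI allI impI)
  fix u v t
  assume uv: "u \<in> section_at X (strict R) y" "v \<in> section_at X (strict R) y" and t: "0 \<le> t \<and> t \<le> (1::real)"
  then have X: "u \<in> X" "v \<in> X" "(u, y) \<in> strict R" "(v, y) \<in> strict R"
    by (auto simp: section_at_def)
  \<comment> \<open>Choose \<open>w\<close> as the less preferred of \<open>u\<close> and
    \<open>v\<close>; the weak section at \<open>w\<close> is convex, contains both, and lies
    strictly above \<open>y\<close>.\<close>
  then obtain w where w: "w \<in> X" "(w, y) \<in> strict R" "(u, w) \<in> R" "(v, w) \<in> R"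
    using refl complete unfolding complete_on_def by metis
  then have "(1 - t) *\<^sub>R u + t *\<^sub>R v \<in> section_at X R w"
    using assms X t unfolding convex_pref_def convex_alt section_at_def by blast
  then show "(1 - t) *\<^sub>R u + t *\<^sub>R v \<in> section_at X (strict R) y"
    using w(2) pref_strict_trans by (auto simp: section_at_def)
qed

lemma archimedean_imp_closed_section:
  assumes "archimedean X R" "convex_pref X R" "x \<in> X"
  shows "closedin (top_of_set X) (section_at X R x)"
proof -
  let ?A = "section_at X R x"
  have cvx: "convex ?A" using assms by (simp add: convex_pref_def)
  have "y \<in> ?A" if y: "y \<in> X" "y \<in> closure ?A" for y
  proof (rule ccontr)
    assume "y \<notin> ?A"
    then have xy: "(x, y) \<in> strict R"
      using y assms(3) by (simp add: section_at_def strict_iff)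
    have "rel_interior ?A \<noteq> {}"
      using assms(3) refl rel_interior_eq_empty[OF cvx] by (auto simp: section_at_def)
    then obtain z where z: "z \<in> rel_interior ?A" by blast
    then have "z \<in> X" using rel_interior_subset by (fastforce simp: section_at_def)
    then obtain d where d: "d \<in> {0<..<1}" "(x, mix y d z) \<in> strict R"
      using assms y xy unfolding archimedean_def by blast
    \<comment> \<open>This is \<open>mix y d z\<close>, written in the form of the shrinking lemma:
      moving from a point of the closure towards a relative interior point enters the relative
      interior at once. So the mixture is weakly above \<open>x\<close>, against the choice of
      \<open>d\<close>.\<close>
    have "y - (1 - d) *\<^sub>R (y - z) \<in> rel_interior ?A"
      using d by (intro rel_interior_closure_convex_shrink[OF cvx z y(2)]) auto
    moreover have "y - (1 - d) *\<^sub>R (y - z) = mix y d z"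
      by (simp add: mix_def algebra_simps)
    ultimately have "mix y d z \<in> ?A" using rel_interior_subset by fastforce
    then show False using d(2) by (simp add: section_at_def strict_def)
  qed
  then show ?thesis
    unfolding closedin_closed by (intro exI[of _ "closure ?A"])
      (use closure_subset[of ?A] in \<open>auto simp: section_at_def\<close>)
qed

text \<open>The Archimedean property gives one weight per vertex of the polytope \<open>P\<close>,
  and finiteness makes the weight uniform. Contracting \<open>P\<close> towards \<open>x\<close> by
  it lands in the convex section, and every point of \<open>X\<close> near \<open>x\<close> belongs
  to the contracted polytope.\<close>

lemma archimedean_imp_open_section:
  assumes "archimedean X R" "convex_pref X R" "locally_conic X" "y \<in> X"
  shows "openin (top_of_set X) (section_at X (strict R) y)"
proof (rule openin_top_of_set_nhdsI)
  let ?A = "section_at X (strict R) y"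
  show "?A \<subseteq> X" by (auto simp: section_at_def)
  fix x assume "x \<in> ?A"
  then have x: "x \<in> X" "(x, y) \<in> strict R" by (auto simp: section_at_def)
  have cvx: "convex ?A" using assms(2) by (rule convex_strict_section)
  obtain P where P: "polytope P" "P \<subseteq> X"
    and shrink: "\<And>t. 0 < t \<Longrightarrow> t \<le> 1 \<Longrightarrow> \<forall>\<^sub>F z in nhds x. z \<in> X \<longrightarrow> x + (1 / t) *\<^sub>R (z - x) \<in> P"
    using assms(3) x unfolding locally_conic_def by blast
  obtain F where F: "finite F" "P = convex hull F"
    using P unfolding polytope_def by blast
  have FX: "F \<subseteq> X" using F P hull_subset by fastforce
  have "\<exists>l\<in>{0<..<1}. mix x l v \<in> ?A" if "v \<in> F" for v
  proof -
    have "\<exists>l\<in>{0<..<1}. (mix x l v, y) \<in> strict R"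
      using assms(1,4) x that FX unfolding archimedean_def by blast
    then show ?thesis using strict_mem by (auto simp: section_at_def)
  qed
  then obtain l where l: "\<And>v. v \<in> F \<Longrightarrow> l v \<in> {0<..<1} \<and> mix x (l v) v \<in> ?A" by metis
  \<comment> \<open>Inserting 1/2 makes the maximum well defined even for empty \<open>F\<close>,
    and the value stays strictly between 0 and 1.\<close>
  define k where "k = Max (insert (1/2) (l ` F))"
  have k: "0 < k" "k < 1" "\<And>v. v \<in> F \<Longrightarrow> l v \<le> k"
    unfolding k_def using F(1) l by (auto simp: less_max_iff_disj Max_gr_iff)
  have "mix x k v \<in> ?A" if "v \<in> F" for v
  proof -
    have "l v < 1" "l v \<le> k" using l k that by auto
    \<comment> \<open>\<open>c\<close> is the weight that moves \<open>mix x (l v) v\<close> further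
      towards \<open>x\<close>, up to weight \<open>k\<close>; the section is convex and contains
      both ends.\<close>
    define c where "c = (k - l v) / (1 - l v)"
    have "c * (1 - l v) = k - l v" using \<open>l v < 1\<close> by (simp add: c_def)
    then have "k = c + (1 - c) * l v" by (simp add: algebra_simps)
    then have "mix x k v = mix x c (mix x (l v) v)" by (simp add: mix_mix)
    moreover have "0 \<le> c" "c \<le> 1" using \<open>l v < 1\<close> \<open>l v \<le> k\<close> k(2) by (auto simp: c_def)
    ultimately show ?thesis
      using mix_in_convex[OF cvx \<open>x \<in> ?A\<close>] l[OF that] by auto
  qed
  then have hull: "convex hull ((\<lambda>v. mix x k v) ` F) \<subseteq> ?A"
    by (intro hull_minimal cvx) auto
  have in_hull: "mix x k p \<in> ?A" if "p \<in> P" for p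
  proof -
    \<comment> \<open>The contraction is affine, so it commutes with convex hulls.\<close>
    have "(\<lambda>v. mix x k v) ` (convex hull F) = convex hull ((\<lambda>v. mix x k v) ` F)"
      using convex_hull_affinity[of "k *\<^sub>R x" "1 - k" F] by (simp add: mix_def)
    then show ?thesis using hull that F(2) by blast
  qed
  show "\<forall>\<^sub>F z in nhds x. z \<in> X \<longrightarrow> z \<in> ?A"
  proof (rule eventually_mono)
    show "\<forall>\<^sub>F z in nhds x. z \<in> X \<longrightarrow> x + (1 / (1 - k)) *\<^sub>R (z - x) \<in> P"
      using k by (intro shrink) auto
    fix z assume z: "z \<in> X \<longrightarrow> x + (1 / (1 - k)) *\<^sub>R (z - x) \<in> P"
    \<comment> \<open>Dilation by \<open>1 / (1 - k)\<close> is inverse to the contraction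
      \<open>mix x k\<close>, so \<open>z\<close> is the contraction of a point of
      \<open>P\<close>.\<close>
    have "(1 - k) *\<^sub>R (x + (1 / (1 - k)) *\<^sub>R (z - x)) = (1 - k) *\<^sub>R x + (z - x)"
      using k(2) by (simp add: scaleR_right_distrib)
    then have "mix x k (x + (1 / (1 - k)) *\<^sub>R (z - x)) = z"
      by (simp add: mix_def algebra_simps)
    then show "z \<in> X \<longrightarrow> z \<in> ?A"
      using in_hull z by metis
  qed
qed

lemma archimedean_convex_imp_continuous:
  assumes "archimedean X R" "convex_pref X R" "locally_conic X"
  shows "continuous_pref X R"
proof -
  have "openin (top_of_set X) (section_at X ((strict R)\<inverse>) x)" if "x \<in> X" for x
  proof -
    have "section_at X ((strict R)\<inverse>) x = X - section_at X R x"
      using that by (auto simp: section_at_def strict_iff)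
    then show ?thesis
      using archimedean_imp_closed_section[OF assms(1,2) that]
      by (simp add: openin_diff)
  qed
  then show ?thesis
    using archimedean_imp_open_section[OF assms] by (simp add: continuous_pref_iff)
qed

end

section \<open>Archimedean monotonic preferences are continuous\<close>

lemma bounded_pairs_finite:
  assumes "bounded_pairs X" "finite F" "F \<subseteq> X" "x \<in> X"
  shows "\<exists>a\<in>X. \<exists>b\<in>X. b \<le> x \<and> x \<le> a \<and> (\<forall>v\<in>F. b \<le> v \<and> v \<le> a)"
  using assms(2,3)
proof (induction F)
  case empty
  then show ?case using assms(4) by auto
next
  case (insert u F)
  then obtain a b where ab: "a \<in> X" "b \<in> X" "b \<le> x \<and> x \<le> a" "\<forall>v\<in>F. b \<le> v \<and> v \<le> a"
    by auto
  obtain a' where "a' \<in> X" "u \<le> a'" "a \<le> a'"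
    using assms(1) insert.prems ab unfolding bounded_pairs_def by blast
  moreover obtain b' where "b' \<in> X" "b' \<le> u" "b' \<le> b"
    using assms(1) insert.prems ab unfolding bounded_pairs_def by blast
  ultimately show ?case
    using ab by (intro bexI[of _ a'] bexI[of _ b']) (auto intro: order_trans)
qed

text \<open>For each coordinate choose a point of \<open>X\<close> below \<open>x\<close> there and
  one above, with \<open>x\<close> itself as default when none exists. These are finitely many
  points, so common bounds \<open>a\<close> and \<open>b\<close> exist in \<open>X\<close> and
  inherit the strict inequalities.\<close>

lemma bounded_pairs_extreme:
  fixes X :: "(real ^ 'n) set"
  assumes "bounded_pairs X" "x \<in> X"
  obtains a b where "a \<in> X" "b \<in> X" "b \<le> x" "x \<le> a"
    and "\<And>i z. z \<in> X \<Longrightarrow> z $ i < x $ i \<Longrightarrow> b $ i < x $ i"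
    and "\<And>i z. z \<in> X \<Longrightarrow> x $ i < z $ i \<Longrightarrow> x $ i < a $ i"
proof -
  have "\<exists>v\<in>X. (\<exists>z\<in>X. z $ i < x $ i) \<longrightarrow> v $ i < x $ i" for i using assms(2) by blast
  then obtain v where v: "\<And>i. v i \<in> X" "\<And>i z. z \<in> X \<Longrightarrow> z $ i < x $ i \<Longrightarrow> v i $ i < x $ i"
    by metis
  have "\<exists>u\<in>X. (\<exists>z\<in>X. x $ i < z $ i) \<longrightarrow> x $ i < u $ i" for i using assms(2) by blast
  then obtain u where u: "\<And>i. u i \<in> X" "\<And>i z. z \<in> X \<Longrightarrow> x $ i < z $ i \<Longrightarrow> x $ i < u i $ i"
    by metis
  have "finite (range u \<union> range v)" "range u \<union> range v \<subseteq> X"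
    using u(1) v(1) by auto
  from bounded_pairs_finite[OF assms(1) this assms(2)]
  obtain a b where "a \<in> X" "b \<in> X" "b \<le> x" "x \<le> a"
    and ab: "\<forall>w\<in>range u \<union> range v. b \<le> w \<and> w \<le> a"
    by blast
  show ?thesis
  proof (rule that)
    show "b $ i < x $ i" if "z \<in> X" "z $ i < x $ i" for i z
      using v(2)[OF that] ab by (meson UnI2 le_less_trans less_eq_vec_def rangeI)
    show "x $ i < a $ i" if "z \<in> X" "x $ i < z $ i" for i z
      using u(2)[OF that] ab by (meson UnI1 less_le_trans less_eq_vec_def rangeI)
  qed fact+
qed

text \<open>Argue by coordinates. Where \<open>b\<close> is strictly below \<open>x\<close>, so is
  the mixture, and the strict inequality persists near \<open>x\<close>. Elsewhere \<open>b\<close>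
  and \<open>x\<close> agree, and no point of \<open>X\<close> is lower than \<open>x\<close> in
  that coordinate. The upper bound is dual, and there are finitely many coordinates.\<close>

lemma eventually_between_mix:
  fixes X :: "(real ^ 'n) set"
  assumes "b \<le> x" "x \<le> a" "l < 1"
    and "\<And>i z. z \<in> X \<Longrightarrow> z $ i < x $ i \<Longrightarrow> b $ i < x $ i"
    and "\<And>i z. z \<in> X \<Longrightarrow> x $ i < z $ i \<Longrightarrow> x $ i < a $ i"
  shows "\<forall>\<^sub>F z in nhds x. z \<in> X \<longrightarrow> mix x l b \<le> z \<and> z \<le> mix x l a"
proof -
  have "\<forall>\<^sub>F z in nhds x. z \<in> X \<longrightarrow> mix x l b $ i \<le> z $ i \<and> z $ i \<le> mix x l a $ i" for i
  proof -
    have lim: "((\<lambda>z. z $ i) \<longlongrightarrow> x $ i) (nhds x)"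
      by (intro tendsto_vec_nth) (simp add: filterlim_ident)
    have lo: "mix x l b $ i = x $ i - (1 - l) * (x $ i - b $ i)"
      and hi: "mix x l a $ i = x $ i + (1 - l) * (a $ i - x $ i)"
      by (simp_all add: mix_def algebra_simps)
    have le: "b $ i \<le> x $ i" "x $ i \<le> a $ i" using assms(1,2) by (auto simp: less_eq_vec_def)
    have "\<forall>\<^sub>F z in nhds x. z \<in> X \<longrightarrow> mix x l b $ i \<le> z $ i"
    proof (cases "b $ i < x $ i")
      case True
      then have "mix x l b $ i < x $ i" using assms(3) by (simp add: lo)
      then show ?thesis
        using eventually_mono[OF order_tendstoD(1)[OF lim]] by (simp add: less_imp_le)
    next
      case False
      then show ?thesis
        using le assms(4)[of _ i] by (intro always_eventually) (force simp: lo not_less)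
    qed
    moreover have "\<forall>\<^sub>F z in nhds x. z \<in> X \<longrightarrow> z $ i \<le> mix x l a $ i"
    proof (cases "x $ i < a $ i")
      case True
      then have "x $ i < mix x l a $ i" using assms(3) by (simp add: hi)
      then show ?thesis
        using eventually_mono[OF order_tendstoD(2)[OF lim]] by (simp add: less_imp_le)
    next
      case False
      then show ?thesis
        using le assms(5)[of _ i] by (intro always_eventually) (force simp: hi not_less)
    qed
    ultimately show ?thesis by eventually_elim auto
  qed
  then have "\<forall>\<^sub>F z in nhds x. \<forall>i. z \<in> X \<longrightarrow> mix x l b $ i \<le> z $ i \<and> z $ i \<le> mix x l a $ i"
    by (rule eventually_all_finite)
  then show ?thesis by eventually_elim (auto simp: less_eq_vec_def)
qed

lemma archimedean_monotonic_imp_continuous: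
  fixes X :: "(real ^ 'n) set"
  assumes "convex_weak_order X R" "archimedean X R" "bounded_pairs X" "weakly_monotonic X R"
  shows "continuous_pref X R"
proof -
  interpret convex_weak_order X R by fact
  have mono: "(u, v) \<in> R" if "u \<in> X" "v \<in> X" "v \<le> u" for u v
    using assms(4) that refl unfolding weakly_monotonic_def by blast
  have upper: "\<forall>\<^sub>F z in nhds x. z \<in> X \<longrightarrow> (z, y) \<in> strict R"
    and lower: "\<forall>\<^sub>F z in nhds y. z \<in> X \<longrightarrow> (x, z) \<in> strict R" if xy: "(x, y) \<in> strict R" for x y
  proof -
    have X: "x \<in> X" "y \<in> X" using xy strict_mem by blast+
    obtain a b where ab: "a \<in> X" "b \<in> X" "b \<le> x" "x \<le> a"
      "\<And>i z. z \<in> X \<Longrightarrow> z $ i < x $ i \<Longrightarrow> b $ i < x $ i"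
      "\<And>i z. z \<in> X \<Longrightarrow> x $ i < z $ i \<Longrightarrow> x $ i < a $ i"
      using bounded_pairs_extreme[OF assms(3) X(1)] by blast
    obtain l where l: "l \<in> {0<..<1}" "(mix x l b, y) \<in> strict R"
      using assms(2) X ab(2) xy unfolding archimedean_def by blast
    have "\<forall>\<^sub>F z in nhds x. z \<in> X \<longrightarrow> mix x l b \<le> z \<and> z \<le> mix x l a"
      using l(1) by (intro eventually_between_mix ab(3,4)) (auto dest: ab(5,6))
    then show "\<forall>\<^sub>F z in nhds x. z \<in> X \<longrightarrow> (z, y) \<in> strict R"
      \<comment> \<open>Monotonicity puts \<open>z\<close> weakly above \<open>mix x l b\<close>,
        which is strictly above \<open>y\<close>.\<close>
      by eventually_elim (use l(2) mono strict_mem pref_strict_trans in blast)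
    obtain a b where ab: "a \<in> X" "b \<in> X" "b \<le> y" "y \<le> a"
      "\<And>i z. z \<in> X \<Longrightarrow> z $ i < y $ i \<Longrightarrow> b $ i < y $ i"
      "\<And>i z. z \<in> X \<Longrightarrow> y $ i < z $ i \<Longrightarrow> y $ i < a $ i"
      using bounded_pairs_extreme[OF assms(3) X(2)] by blast
    obtain l where l: "l \<in> {0<..<1}" "(x, mix y l a) \<in> strict R"
      using assms(2) X ab(1) xy unfolding archimedean_def by blast
    have "\<forall>\<^sub>F z in nhds y. z \<in> X \<longrightarrow> mix y l b \<le> z \<and> z \<le> mix y l a"
      using l(1) by (intro eventually_between_mix ab(3,4)) (auto dest: ab(5,6))
    then show "\<forall>\<^sub>F z in nhds y. z \<in> X \<longrightarrow> (x, z) \<in> strict R"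
      by eventually_elim (use l(2) mono strict_mem strict_pref_trans in blast)
  qed
  \<comment> \<open>Stated for a general \<open>S\<close> so that it serves both
    \<open>strict R\<close> and its converse.\<close>
  have open_sec: "openin (top_of_set X) (section_at X S y)"
    if "\<And>x. (x, y) \<in> S \<Longrightarrow> \<forall>\<^sub>F z in nhds x. z \<in> X \<longrightarrow> (z, y) \<in> S" for S y
  proof (rule openin_top_of_set_nhdsI)
    fix x assume "x \<in> section_at X S y"
    then show "\<forall>\<^sub>F z in nhds x. z \<in> X \<longrightarrow> z \<in> section_at X S y"
      using that by (simp add: section_at_def)
  qed (auto simp: section_at_def)
  then show ?thesis
    unfolding continuous_pref_iff
    by (intro ballI conjI open_sec) (auto intro: upper lower)
qed

theorem theorem3:
  fixes X :: "(real ^ 'n) set" and R :: "(real ^ 'n) rel"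
  assumes "convex X"
    and "R \<subseteq> X \<times> X"
    and "complete_on X R"
    and "trans R"
    and "((open X \<or> polyhedron X) \<and> convex_pref X R)
       \<or> (bounded_pairs X \<and> weakly_monotonic X R)"
  shows "(graph_continuous X R \<longleftrightarrow> continuous_pref X R)
       \<and> (continuous_pref X R \<longleftrightarrow> linearly_continuous X R)
       \<and> (linearly_continuous X R \<longleftrightarrow> mixture_continuous X R)
       \<and> (mixture_continuous X R \<longleftrightarrow> archimedean X R)
       \<and> (archimedean X R \<longleftrightarrow> wold_continuous X R)
       \<and> (wold_continuous X R \<longleftrightarrow> weakly_wold_continuous X R)"
proof -
  interpret convex_weak_order X R
    using assms by unfold_locales
  \<comment> \<open>This arrow closes both cycles, through linear and mixture continuity and through
    the Wold properties.\<close>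
  have "archimedean X R \<Longrightarrow> continuous_pref X R"
    using assms(5) archimedean_convex_imp_continuous open_imp_locally_conic
      polyhedron_imp_locally_conic
      archimedean_monotonic_imp_continuous[OF convex_weak_order_axioms]
    by blast
  then show ?thesis
    using graph_continuous_imp_continuous continuous_imp_graph_continuous
      continuous_imp_linearly_continuous linearly_continuous_imp_mixture_continuous
      mixture_continuous_imp_archimedean continuous_imp_wold_continuous
      wold_continuous_imp_weakly_wold_continuous weakly_wold_continuous_imp_archimedean
    by blast
qed

end
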